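(* Let $\theta=(k_r)_{r\ge 0}$ be a lacunary sequence and let $q_r=k_r/k_{r-1}$. If $\liminf_{r\to\infty} q_r>1$, then $ASC\subseteq ASC_\theta$.
   Context: Sequences $x=(x_m)$ are real sequences indexed by the positive integers. For positive integers $m,n$, $\langle m,n\rangle$ denotes the greatest common divisor of $m$ and $n$. The number of elements of a finite set $A$ is denoted $|A|$. A lacunary sequence is a strictly increasing sequence $\theta=(k_r)_{r\ge 0}$ of nonnegative integers such that $h_r:=k_r-k_{r-1}\to\infty$ as $r\to\infty$. For $r\ge1$ put $I_r=(k_{r-1},k_r]$ (viewed as a set of integers), and $q_r=k_r/k_{r-1}$ (for those $r\ge 1$ with $k_{r-1}\neq 0$). $ASC$ is the set of all arithmetic statistically convergent sequences: $x\in ASC$ iff for each $\varepsilon>0$ there is a positive integer $n$ such that $$\lim_{t\to\infty}\frac1t\left|\{m\le t: |x_m-x_{\langle m,n\rangle}|\ge\varepsilon\}\right|=0.$$ $ASC_\theta$ is the set of all lacunary arithmetic statistically convergent sequences: $x\in ASC_\theta$ iff for each $\varepsilon>0$ there is a positive integer $n$ such that $$\lim_{r\to\infty}\frac1{h_r}\left|\{m\in I_r: |x_m-x_{\langle m,n\rangle}|\ge\varepsilon\}\right|=0.$$ *)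

theory Defs
  imports "HOL-Analysis.Analysis"
begin

text \<open>
  Sequences indexed by the positive integers are functions \<open>nat \<Rightarrow> real\<close> whose value at \<open>0\<close> is never
  consulted: below \<open>m\<close> and \<open>n\<close> are positive, hence so is \<open>gcd m n\<close>.
  The terms \<open>lac_h k r\<close>, \<open>lac_I k r\<close>, \<open>lac_q k r\<close> are meant for \<open>r \<ge> 1\<close>; \<open>lac_q k 1\<close> is \<open>0\<close> when
  \<open>k 0 = 0\<close>. These finitely many junk values do not affect limits as \<open>r\<close> tends to infinity.
\<close>

definition lac_h :: "(nat \<Rightarrow> nat) \<Rightarrow> nat \<Rightarrow> nat" where
  "lac_h k r = k r - k (r - 1)"

definition lac_I :: "(nat \<Rightarrow> nat) \<Rightarrow> nat \<Rightarrow> nat set" where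
  "lac_I k r = {k (r - 1)<..k r}"

definition lac_q :: "(nat \<Rightarrow> nat) \<Rightarrow> nat \<Rightarrow> real" where
  "lac_q k r = real (k r) / real (k (r - 1))"

definition lacunary :: "(nat \<Rightarrow> nat) \<Rightarrow> bool" where
  "lacunary k \<longleftrightarrow> strict_mono k \<and> filterlim (lac_h k) at_top sequentially"

definition ASC :: "(nat \<Rightarrow> real) set" where
  "ASC = {x. \<forall>\<epsilon>>0. \<exists>n\<ge>1.
     (\<lambda>t. real (card {m \<in> {1..t}. \<bar>x m - x (gcd m n)\<bar> \<ge> \<epsilon>}) / real t) \<longlonglongrightarrow> 0}"

definition ASC_lac :: "(nat \<Rightarrow> nat) \<Rightarrow> (nat \<Rightarrow> real) set" where
  "ASC_lac k = {x. \<forall>\<epsilon>>0. \<exists>n\<ge>1.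
     (\<lambda>r. real (card {m \<in> lac_I k r. \<bar>x m - x (gcd m n)\<bar> \<ge> \<epsilon>}) / real (lac_h k r)) \<longlonglongrightarrow> 0}"

end

theory Submission
  imports Defs
begin

text \<open>Fix c with 1 < c < liminf q_r. For all large r, k_(r-1) < k_r / c, so the block I_r
  fills at least the fraction 1 - 1/c of {1..k_r}. A set's density in I_r is therefore at most
  c/(c-1) times its density in {1..k_r} (\<open>lac_density_le\<close>). The latter densities are a
  subsequence of the ordinary ones, so a set of density zero also has lacunary density zero
  (\<open>lac_density_tendsto_0\<close>). This is applied to the exceptional set of each
  \<epsilon>.\<close>

lemma lac_h_ge_of_ratio:
  assumes "1 < c" and "c < lac_q k r"
  shows "(1 - 1 / c) * real (k r) \<le> real (lac_h k r)" and "0 < k r"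
proof -
  \<comment> \<open>Division by zero would make the quotient 0, contradicting
    \<open>c < lac_q k r\<close>.\<close>
  have pos: "0 < real (k (r - 1))"
    using assms by (cases "k (r - 1) = 0") (auto simp: lac_q_def)
  then have "c * real (k (r - 1)) < real (k r)"
    using assms by (simp add: lac_q_def field_simps)
  then have le: "real (k (r - 1)) \<le> real (k r) / c"
    using assms by (simp add: field_simps)
  also have "\<dots> \<le> real (k r)"
    using assms by (simp add: divide_le_eq mult_le_cancel_left1)
  \<comment> \<open>The subtraction in \<open>lac_h\<close> truncates on naturals; this order lets
    it pass to the reals.\<close>
  finally have mono: "k (r - 1) \<le> k r"
    by simp
  then show "0 < k r"
    using pos by simp
  show "(1 - 1 / c) * real (k r) \<le> real (lac_h k r)"
    using le mono by (simp add: lac_h_def of_nat_diff algebra_simps)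
qed

text \<open>Replacing I_r by {1..k_r} can only raise the count, while the normalising length grows
  by a factor of at most 1 / (1 - 1/c) = c/(c-1).\<close>

lemma lac_density_le:
  assumes "1 < c" and "c < lac_q k r"
  shows "real (card {m \<in> lac_I k r. P m}) / real (lac_h k r)
    \<le> c / (c - 1) * (real (card {m \<in> {1..k r}. P m}) / real (k r))"
proof -
  have "0 < (1 - 1 / c) * real (k r)"
    using assms lac_h_ge_of_ratio(2)[OF assms] by simp
  moreover have "card {m \<in> lac_I k r. P m} \<le> card {m \<in> {1..k r}. P m}"
    by (rule card_mono) (auto simp: lac_I_def)
  ultimately have "real (card {m \<in> lac_I k r. P m}) / real (lac_h k r)
      \<le> real (card {m \<in> {1..k r}. P m}) / ((1 - 1 / c) * real (k r))"
    using lac_h_ge_of_ratio(1)[OF assms] by (intro frac_le) auto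
  also have "\<dots> = c / (c - 1) * (real (card {m \<in> {1..k r}. P m}) / real (k r))"
    using assms by (simp add: field_simps)
  finally show ?thesis .
qed

lemma lac_density_tendsto_0:
  assumes "strict_mono k" and "1 < c" and "\<forall>\<^sub>F r in sequentially. c < lac_q k r"
    and "(\<lambda>t. real (card {m \<in> {1..t}. P m}) / real t) \<longlonglongrightarrow> 0"
  shows "(\<lambda>r. real (card {m \<in> lac_I k r. P m}) / real (lac_h k r)) \<longlonglongrightarrow> 0"
proof (rule tendsto_sandwich[where f = "\<lambda>_. 0"])
  show "\<forall>\<^sub>F r in sequentially. real (card {m \<in> lac_I k r. P m}) / real (lac_h k r)
      \<le> c / (c - 1) * (real (card {m \<in> {1..k r}. P m}) / real (k r))"
    using assms(3) by eventually_elim (rule lac_density_le[OF assms(2)])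
  show "(\<lambda>r. c / (c - 1) * (real (card {m \<in> {1..k r}. P m}) / real (k r))) \<longlonglongrightarrow> 0"
    \<comment> \<open>Sample the ordinary densities along t = k_r, which tends to infinity by strict
      monotonicity.\<close>
    using filterlim_compose[OF assms(4) filterlim_subseq[OF assms(1)]]
    by (rule tendsto_mult_right_zero)
qed auto

theorem theorem2p6:
  fixes k :: "nat \<Rightarrow> nat"
  assumes "lacunary k"
    and "liminf (\<lambda>r. ereal (lac_q k r)) > 1"
  shows "ASC \<subseteq> ASC_lac k"
proof -
  \<comment> \<open>Density of the reals in \<open>ereal\<close> gives a finite c even when the
    liminf is infinite.\<close>
  obtain c where "ereal 1 < ereal c" and c: "ereal c < liminf (\<lambda>r. ereal (lac_q k r))"
    using ereal_dense2[OF assms(2)] by (auto simp: one_ereal_def)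
  moreover have "\<forall>\<^sub>F r in sequentially. c < lac_q k r"
    using less_LiminfD[OF c] by simp
  moreover have "strict_mono k"
    using assms(1) by (simp add: lacunary_def)
  \<comment> \<open>For each \<epsilon>, the n supplied by \<open>ASC\<close> serves unchanged for
    \<open>ASC_lac\<close>.\<close>
  ultimately show ?thesis
    unfolding ASC_def ASC_lac_def by (fastforce intro: lac_density_tendsto_0[of k c])
qed

end
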